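(* Let $\mathcal H$ be a Hilbert space and let $\{f_k\}_{k\in\mathbb Z}=\{T^kf_0\}_{k\in\mathbb Z}$ be a frame for $\mathcal H$, where $T\in B(\mathcal H)$ is invertible, and let $S$ denote its frame operator and $\widetilde{f_0}:=S^{-1}f_0$. Then the dual frames of $\{f_k\}_{k\in\mathbb Z}$ given as iterates of a bounded operator are precisely the families of the form $\{(T^* )^{-k}g_0\}_{k\in\mathbb Z}$ for which $$g_0=S^{-1}f_0+h_0-\sum_{j\in\mathbb Z}\langle S^{-1}f_0,T^jf_0\rangle (T^* )^{-j}h_0$$ for some $h_0\in\mathcal H$ such that $\{(T^* )^{-k}h_0\}_{k\in\mathbb Z}$ is a Bessel sequence. In particular, this condition (that $\{(T^* )^{-k}h_0\}_{k\in\mathbb Z}$ is a Bessel sequence) is satisfied when $h_0$ is taken from the dense subspace $\operatorname{span}\{(T^* )^{-k}\widetilde{f_0}\}_{k\in\mathbb Z}$ of $\mathcal H$.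
   Context: A sequence $\{f_k\}_{k\in\mathbb Z}$ is a Bessel sequence if there is $B>0$ with $\sum_{k}|\langle f,f_k\rangle|^2\le B\|f\|^2$ for all $f\in\mathcal H$, and a frame for $\mathcal H$ if in addition there is $A>0$ with $A\|f\|^2\le\sum_k|\langle f,f_k\rangle|^2$ for all $f\in\mathcal H$. The synthesis operator is $U:\ell^2(\mathbb Z)\to\mathcal H$, $U\{c_k\}=\sum_{k\in\mathbb Z}c_kf_k$, and the frame operator is $S=UU^*$, invertible for a frame. A dual frame of $\{f_k\}_{k\in\mathbb Z}$ is a frame $\{g_k\}_{k\in\mathbb Z}$ for $\mathcal H$ with $f=\sum_{k\in\mathbb Z}\langle f,g_k\rangle f_k$ for all $f\in\mathcal H$. $\{f_k\}=\{T^kf_0\}$ means $f_k=T^kf_0$ for all $k\in\mathbb Z$. A dual frame $\{g_k\}_{k\in\mathbb Z}$ is given as iterates of a bounded operator if there is a bounded linear operator $V$ (on $\operatorname{span}\{g_k\}_{k\in\mathbb Z}$, identified with its bounded extension to $\mathcal H$) that maps $\operatorname{span}\{g_k\}_{k\in\mathbb Z}$ bijectively onto itself and satisfies $g_k=V^kg_0$ for all $k\in\mathbb Z$, where $V^k:=(V^{-1})^{-k}$ for $k<0$ with the inverse taken on the span. Here $\operatorname{span}$ denotes finite linear combinations. *)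

theory Defs
  imports "HOL-Analysis.Analysis"
begin

section \<open>Complex Hilbert spaces\<close>

class scaleC =
  fixes scaleC :: "complex \<Rightarrow> 'a \<Rightarrow> 'a" (infixr "*\<^sub>C" 75)

class complex_vector = real_vector + scaleC +
  assumes scaleC_add_right: "a *\<^sub>C (x + y) = a *\<^sub>C x + a *\<^sub>C y"
    and scaleC_add_left: "(a + b) *\<^sub>C x = a *\<^sub>C x + b *\<^sub>C x"
    and scaleC_scaleC: "a *\<^sub>C (b *\<^sub>C x) = (a * b) *\<^sub>C x"
    and scaleC_one: "1 *\<^sub>C x = x"
    and scaleR_scaleC: "r *\<^sub>R x = complex_of_real r *\<^sub>C x"

text \<open>The inner product is linear in the first argument and conjugate-linear in the second.
  Positive definiteness is a consequence of the last axiom and the norm axioms.\<close>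

class complex_inner = complex_vector + real_normed_vector +
  fixes cinner :: "'a \<Rightarrow> 'a \<Rightarrow> complex"
  assumes cinner_commute: "cinner x y = cnj (cinner y x)"
    and cinner_add_left: "cinner (x + y) z = cinner x z + cinner y z"
    and cinner_scaleC_left: "cinner (a *\<^sub>C x) y = a * cinner x y"
    and norm_eq_sqrt_cinner: "norm x = sqrt (Re (cinner x x))"

class chilbert_space = complex_inner + banach

interpretation complex_vector: vector_space "scaleC :: complex \<Rightarrow> 'a \<Rightarrow> 'a::complex_vector"
  by unfold_locales (fact scaleC_add_right scaleC_add_left scaleC_scaleC scaleC_one)+

abbreviation cspan :: "'a::complex_vector set \<Rightarrow> 'a set"
  where "cspan \<equiv> complex_vector.span"


section \<open>Bounded operators\<close>

definition bounded_clinear :: "('a::complex_inner \<Rightarrow> 'b::complex_inner) \<Rightarrow> bool"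
  where "bounded_clinear T \<longleftrightarrow>
    Vector_Spaces.linear scaleC scaleC T \<and> (\<exists>K. \<forall>x. norm (T x) \<le> K * norm x)"

definition invertible_clinear :: "('a::complex_inner \<Rightarrow> 'a) \<Rightarrow> bool"
  where "invertible_clinear T \<longleftrightarrow>
    bounded_clinear T \<and> (\<exists>R. bounded_clinear R \<and> T \<circ> R = id \<and> R \<circ> T = id)"

definition cadjoint :: "('a::complex_inner \<Rightarrow> 'b::complex_inner) \<Rightarrow> 'b \<Rightarrow> 'a"
  where "cadjoint T = (THE R. \<forall>x y. cinner (T x) y = cinner x (R y))"

text \<open>Integer powers of a bijection \<open>V\<close> of \<open>W\<close>; the inverse is taken on \<open>W\<close>.\<close>

definition int_iter_on :: "'a set \<Rightarrow> ('a \<Rightarrow> 'a) \<Rightarrow> int \<Rightarrow> 'a \<Rightarrow> 'a"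
  where "int_iter_on W V k = (if 0 \<le> k then V ^^ nat k else inv_into W V ^^ nat (- k))"

abbreviation int_iter :: "('a \<Rightarrow> 'a) \<Rightarrow> int \<Rightarrow> 'a \<Rightarrow> 'a"
  where "int_iter \<equiv> int_iter_on UNIV"


section \<open>Frames indexed by the integers\<close>

definition bessel :: "(int \<Rightarrow> 'a::complex_inner) \<Rightarrow> bool"
  where "bessel f \<longleftrightarrow> (\<exists>B>0. \<forall>x.
    (\<lambda>k. (cmod (cinner x (f k)))\<^sup>2) summable_on UNIV \<and>
    (\<Sum>\<^sub>\<infinity>k. (cmod (cinner x (f k)))\<^sup>2) \<le> B * (norm x)\<^sup>2)"

definition is_frame :: "(int \<Rightarrow> 'a::complex_inner) \<Rightarrow> bool"
  where "is_frame f \<longleftrightarrow> bessel f \<and>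
    (\<exists>A>0. \<forall>x. A * (norm x)\<^sup>2 \<le> (\<Sum>\<^sub>\<infinity>k. (cmod (cinner x (f k)))\<^sup>2))"

definition ell2 :: "(int \<Rightarrow> complex) set"
  where "ell2 = {c. (\<lambda>k. (cmod (c k))\<^sup>2) summable_on UNIV}"

definition ell2_inner :: "(int \<Rightarrow> complex) \<Rightarrow> (int \<Rightarrow> complex) \<Rightarrow> complex"
  where "ell2_inner c d = (\<Sum>\<^sub>\<infinity>k. c k * cnj (d k))"

definition synthesis :: "(int \<Rightarrow> 'a::complex_inner) \<Rightarrow> (int \<Rightarrow> complex) \<Rightarrow> 'a"
  where "synthesis f c = (\<Sum>\<^sub>\<infinity>k. c k *\<^sub>C f k)"

text \<open>The Hilbert space adjoint of \<open>synthesis f\<close> as an operator from \<open>ell2\<close>.\<close>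

definition synthesis_adjoint :: "(int \<Rightarrow> 'a::complex_inner) \<Rightarrow> 'a \<Rightarrow> int \<Rightarrow> complex"
  where "synthesis_adjoint f x =
    (THE d. d \<in> ell2 \<and> (\<forall>c\<in>ell2. cinner (synthesis f c) x = ell2_inner c d))"

definition frame_operator :: "(int \<Rightarrow> 'a::complex_inner) \<Rightarrow> 'a \<Rightarrow> 'a"
  where "frame_operator f = synthesis f \<circ> synthesis_adjoint f"

definition dual_frame :: "(int \<Rightarrow> 'a::complex_inner) \<Rightarrow> (int \<Rightarrow> 'a) \<Rightarrow> bool"
  where "dual_frame f g \<longleftrightarrow> is_frame g \<and>
    (\<forall>x. ((\<lambda>k. cinner x (g k) *\<^sub>C f k) has_sum x) UNIV)"

text \<open>Only the values of \<open>V\<close> on the span of the family matter.\<close>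

definition bounded_iterates :: "(int \<Rightarrow> 'a::complex_inner) \<Rightarrow> bool"
  where "bounded_iterates g \<longleftrightarrow> (\<exists>V.
    (\<forall>x\<in>cspan (range g). \<forall>y\<in>cspan (range g). V (x + y) = V x + V y) \<and>
    (\<forall>a. \<forall>x\<in>cspan (range g). V (a *\<^sub>C x) = a *\<^sub>C V x) \<and>
    (\<exists>K. \<forall>x\<in>cspan (range g). norm (V x) \<le> K * norm x) \<and>
    bij_betw V (cspan (range g)) (cspan (range g)) \<and>
    (\<forall>k. g k = int_iter_on (cspan (range g)) V k (g 0)))"

end

theory Submission
  imports Defs
begin

text \<open>Write \<open>R\<close> for the inverse of \<open>T\<^sup>*\<close> and \<open>S\<close> for the frame operator. Shifting the index in
  \<open>S x = \<Sum>k. \<langle>x, f k\<rangle> f k\<close> gives \<open>S R = T S\<close>, so the canonical dual \<open>S\<inverse> f k\<close> is the \<open>R\<close>-orbit of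
  \<open>S\<inverse> f 0\<close>. If a dual frame \<open>g\<close> is the orbit of a bounded \<open>V\<close>, then applying \<open>V\<close> to
  \<open>x = \<Sum>k. \<langle>x, f k\<rangle> g k\<close> yields \<open>V x = \<Sum>k. \<langle>x, f k\<rangle> g (k + 1) = R x\<close> on the span, so \<open>g\<close> is an
  \<open>R\<close>-orbit, and \<open>h0 = g 0\<close> works because the series then sums to \<open>S\<inverse> f 0\<close>. Conversely, with
  \<open>M x = \<Sum>k. \<langle>x, f k\<rangle> h k\<close> for \<open>h k = R\<^sup>k h0\<close>, the operator \<open>M\<close> commutes with \<open>R\<close>, so the orbit of
  \<open>g0\<close> is \<open>S\<inverse> f k + h k - M (S\<inverse> f k)\<close>, and the last two terms cancel in the reconstruction
  formula.\<close>

section \<open>Complex inner product spaces\<close>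

lemma scaleC_zero_left [simp]: "0 *\<^sub>C x = (0::'a::complex_vector)"
  by (rule complex_vector.scale_zero_left)

lemma scaleC_minus_one: "(- 1) *\<^sub>C x = - (x::'a::complex_vector)"
  by (simp add: complex_vector.scale_minus_left scaleC_one)

lemma cinner_zero_left [simp]: "cinner 0 (y::'a::complex_inner) = 0"
  using cinner_scaleC_left[of 0 "0::'a" y] by simp

lemma cinner_minus_left: "cinner (- x) (y::'a::complex_inner) = - cinner x y"
  using cinner_scaleC_left[of "- 1" x y] by (simp add: scaleC_minus_one)

lemma cinner_diff_left: "cinner (x - y) (z::'a::complex_inner) = cinner x z - cinner y z"
  using cinner_add_left[of x "- y" z] by (simp add: cinner_minus_left)

lemma cinner_add_right: "cinner (z::'a::complex_inner) (x + y) = cinner z x + cinner z y"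
  by (metis cinner_add_left cinner_commute complex_cnj_add)

lemma cinner_diff_right: "cinner (z::'a::complex_inner) (x - y) = cinner z x - cinner z y"
  by (metis cinner_diff_left cinner_commute complex_cnj_diff)

lemma cinner_scaleC_right: "cinner (x::'a::complex_inner) (a *\<^sub>C y) = cnj a * cinner x y"
  by (metis cinner_scaleC_left cinner_commute complex_cnj_mult)

lemma cinner_zero_right [simp]: "cinner (x::'a::complex_inner) 0 = 0"
  by (metis cinner_zero_left cinner_commute complex_cnj_zero)

lemma cinner_sum_right: "cinner (x::'a::complex_inner) (\<Sum>i\<in>F. h i) = (\<Sum>i\<in>F. cinner x (h i))"
  by (induction F rule: infinite_finite_induct) (auto simp: cinner_add_right)

lemma mult_cnj_cmod: "z * cnj z = (complex_of_real (cmod z))\<^sup>2"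
  by (metis complex_norm_square of_real_power)

lemma cinner_self: "cinner x (x::'a::complex_inner) = of_real ((norm x)\<^sup>2)"
proof (rule complex_eqI)
  have "0 \<le> Re (cinner x x)"
    using norm_ge_zero[of x] unfolding norm_eq_sqrt_cinner real_sqrt_ge_0_iff .
  then show "Re (cinner x x) = Re (of_real ((norm x)\<^sup>2))"
    by (simp add: norm_eq_sqrt_cinner)
  have "Im (cinner x x) = - Im (cinner x x)"
    using cinner_commute[of x x] by (metis cnj.simps(2))
  then show "Im (cinner x x) = Im (of_real ((norm x)\<^sup>2))"
    by (simp del: of_real_power)
qed

lemma cinner_eqI:
  assumes "\<And>x. cinner x u = cinner x (v::'a::complex_inner)"
  shows "u = v"
proof -
  have "cinner (u - v) (u - v) = 0"
    using assms by (simp add: cinner_diff_right)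
  then show ?thesis
    by (simp add: cinner_self)
qed

text \<open>Cauchy-Schwarz: \<open>a *\<^sub>C y\<close> is the orthogonal projection of
  \<open>x\<close> onto the line of \<open>y\<close>, and the squared norm of the residual is
  nonnegative.\<close>

lemma cmod_cinner_le: "cmod (cinner x y) \<le> norm x * norm (y::'a::complex_inner)"
proof (cases "y = 0")
  case False
  define n where "n = (norm y)\<^sup>2"
  define a where "a = cinner x y / of_real n"
  have n: "n > 0"
    using False by (simp add: n_def)
  have "of_real ((norm (x - a *\<^sub>C y))\<^sup>2)
      = cinner x x - cnj a * cinner x y - a * cinner y x + a * cnj a * cinner y y"
    by (simp add: cinner_self[symmetric] cinner_diff_left cinner_diff_right cinner_scaleC_left
        cinner_scaleC_right algebra_simps del: of_real_power)
  also have "\<dots> = of_real ((norm x)\<^sup>2) - cinner x y * cnj (cinner x y) / of_real n"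
    using n by (simp add: cinner_self cinner_commute[of y x] a_def n_def[symmetric] field_simps
        del: of_real_power)
  also have "\<dots> = of_real ((norm x)\<^sup>2 - (cmod (cinner x y))\<^sup>2 / n)"
    by (simp add: complex_norm_square[symmetric])
  finally have "0 \<le> (norm x)\<^sup>2 - (cmod (cinner x y))\<^sup>2 / n"
    by (metis of_real_eq_iff zero_le_power2)
  then have "(cmod (cinner x y))\<^sup>2 \<le> (norm x * norm y)\<^sup>2"
    using n by (simp add: field_simps n_def)
  then show ?thesis
    by (rule power2_le_imp_le) simp
qed simp

lemma norm_scaleC: "norm (a *\<^sub>C (x::'a::complex_inner)) = cmod a * norm x"
proof -
  have "complex_of_real ((norm (a *\<^sub>C x))\<^sup>2) = of_real ((cmod a * norm x)\<^sup>2)"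
    unfolding cinner_self[symmetric] cinner_scaleC_left cinner_scaleC_right
    by (simp add: cinner_self power_mult_distrib mult_cnj_cmod mult.assoc[symmetric]
        mult.commute[of "cnj a" a])
  then show ?thesis
    by (simp only: of_real_eq_iff) (simp add: power2_eq_iff_nonneg)
qed

lemma bounded_linear_cinner_left: "bounded_linear (\<lambda>x. cinner x (y::'a::complex_inner))"
  by (rule bounded_linear_intro[of _ "norm y"])
    (auto simp: cinner_add_left scaleR_scaleC cinner_scaleC_left scaleR_conv_of_real cmod_cinner_le)

lemma bounded_linear_cinner_right: "bounded_linear (\<lambda>y. cinner (x::'a::complex_inner) y)"
  by (rule bounded_linear_intro[of _ "norm x"])
    (auto simp: cinner_add_right scaleR_scaleC cinner_scaleC_right scaleR_conv_of_real
      cmod_cinner_le mult.commute[of _ "norm x"])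

lemma has_sum_diff:
  fixes u v :: "'i \<Rightarrow> 'a::real_normed_vector"
  assumes "(u has_sum a) A" "(v has_sum b) A"
  shows "((\<lambda>k. u k - v k) has_sum (a - b)) A"
  using has_sum_add[OF assms(1)
      has_sum_bounded_linear[OF bounded_linear_minus[OF bounded_linear_ident] assms(2)]]
  by simp

section \<open>Bounded operators\<close>

lemma bounded_clinearI:
  assumes "\<And>x y. L (x + y) = L x + L y" "\<And>a x. L (a *\<^sub>C x) = a *\<^sub>C L x"
    and "\<And>x. norm (L x) \<le> K * norm x"
  shows "bounded_clinear L"
  unfolding bounded_clinear_def Vector_Spaces.linear_iff
  using assms by (auto intro: complex_vector.vector_space_axioms)

lemma bounded_clinear_linear: "bounded_clinear L \<Longrightarrow> Vector_Spaces.linear scaleC scaleC L"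
  by (simp add: bounded_clinear_def)

lemma bounded_clinear_add: "bounded_clinear L \<Longrightarrow> L (x + y) = L x + L y"
  by (simp add: bounded_clinear_def Vector_Spaces.linear_iff)

lemma bounded_clinear_scaleC: "bounded_clinear L \<Longrightarrow> L (a *\<^sub>C x) = a *\<^sub>C L x"
  by (simp add: bounded_clinear_def Vector_Spaces.linear_iff)

lemma bounded_clinear_bounded_linear: 
  assumes "bounded_clinear L"
  shows "bounded_linear L"
proof -
  obtain K where "\<And>x. norm (L x) \<le> K * norm x"
    using assms by (auto simp: bounded_clinear_def)
  then show ?thesis
    using assms
    by (intro bounded_linear_intro[of _ K])
      (auto simp: bounded_clinear_add bounded_clinear_scaleC scaleR_scaleC mult.commute)
qed

lemma bounded_clinear_diff: "bounded_clinear L \<Longrightarrow> L (x - y) = L x - L y"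
  using bounded_clinear_bounded_linear bounded_linear.linear linear_diff by blast

lemma bounded_clinear_sum: "bounded_clinear L \<Longrightarrow> L (sum h F) = (\<Sum>i\<in>F. L (h i))"
  by (rule linear_sum[OF bounded_linear.linear[OF bounded_clinear_bounded_linear]])

lemma bounded_clinear_scaleC_const: "bounded_clinear (\<lambda>x::'a::complex_inner. a *\<^sub>C x)"
  by (rule bounded_clinearI[of _ "cmod a"])
    (auto simp: scaleC_add_right scaleC_scaleC mult.commute norm_scaleC)

lemma bounded_clinear_pos_bounded:
  assumes "bounded_clinear L"
  obtains K where "K > 0" "\<And>x. norm (L x) \<le> K * norm x"
  using bounded_linear.pos_bounded[OF bounded_clinear_bounded_linear[OF assms]]
  by (metis mult.commute)

lemma bounded_clinear_span_image:
  "bounded_clinear L \<Longrightarrow> L ` cspan A = cspan (L ` A)"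
  using module_hom.span_image[of scaleC scaleC L A] bounded_clinear_linear[of L]
  by (simp add: linear_iff_module_hom)

section \<open>Adjoints\<close>

lemma cadjoint_eqI:
  assumes "\<And>x y. cinner (L x) y = cinner x (M y)"
  shows "cadjoint L = M"
  unfolding cadjoint_def
proof (rule the_equality)
  fix N assume "\<forall>x y. cinner (L x) y = cinner x (N y)"
  then show "N = M"
    using assms by (intro ext cinner_eqI) metis
qed (use assms in blast)

text \<open>Linearity follows by testing against all vectors. For the bound, the squared norm of
  \<open>M y\<close> is the inner product of \<open>L (M y)\<close> and \<open>y\<close>, so one
  factor \<open>norm (M y)\<close> cancels.\<close>

lemma bounded_clinear_adjoint:
  assumes "bounded_clinear L" and adj: "\<And>x y. cinner (L x) y = cinner x (M y)"
  shows "bounded_clinear M"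
proof -
  obtain K where K: "K > 0" "\<And>x. norm (L x) \<le> K * norm x"
    using assms(1) by (rule bounded_clinear_pos_bounded) blast
  show ?thesis
  proof (rule bounded_clinearI)
    show "norm (M y) \<le> K * norm y" for y
    proof -
      have "(norm (M y))\<^sup>2 = cmod (cinner (L (M y)) y)"
        by (simp add: adj cinner_self norm_power)
      also have "\<dots> \<le> K * norm (M y) * norm y"
        using cmod_cinner_le[of "L (M y)" y] mult_right_mono[OF K(2)[of "M y"], of "norm y"] by simp
      finally have "norm (M y) * norm (M y) \<le> norm (M y) * (K * norm y)"
        by (simp add: power2_eq_square ac_simps)
      then show ?thesis
        using K(1) by (cases "M y = 0") auto
    qed
  qed (rule cinner_eqI, simp add: adj[symmetric] cinner_add_right cinner_scaleC_right)+
qed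

section \<open>Bessel sequences\<close>

lemma Cauchy_Schwarz_sum:
  "(\<Sum>i\<in>F. cmod (a i) * cmod (b i))\<^sup>2 \<le> (\<Sum>i\<in>F. (cmod (a i))\<^sup>2) * (\<Sum>i\<in>F. (cmod (b i))\<^sup>2)"
proof -
  have "(\<Sum>i\<in>F. cmod (a i) * cmod (b i)) \<le> L2_set (\<lambda>i. cmod (a i)) F * L2_set (\<lambda>i. cmod (b i)) F"
    using L2_set_mult_ineq[of "\<lambda>i. cmod (a i)" "\<lambda>i. cmod (b i)" F] by simp
  then have "(\<Sum>i\<in>F. cmod (a i) * cmod (b i))\<^sup>2 \<le> (L2_set (\<lambda>i. cmod (a i)) F * L2_set (\<lambda>i. cmod (b i)) F)\<^sup>2"
    by (rule power_mono) (simp add: sum_nonneg)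
  then show ?thesis
    by (simp add: L2_set_def power_mult_distrib sum_nonneg)
qed

text \<open>The Bessel condition seen from the synthesis side. Only finite combinations occur, so it
  passes easily through operators and sums of families.\<close>

definition bessel_bound :: "real \<Rightarrow> ('i \<Rightarrow> 'a::complex_inner) \<Rightarrow> bool"
  where "bessel_bound B u \<longleftrightarrow> B > 0 \<and> (\<forall>F c. finite F \<longrightarrow>
    (norm (\<Sum>k\<in>F. c k *\<^sub>C u k))\<^sup>2 \<le> B * (\<Sum>k\<in>F. (cmod (c k))\<^sup>2))"

text \<open>Expand \<open>cinner v v\<close> for the finite combination \<open>v\<close>, apply
  Cauchy-Schwarz, and use the Bessel inequality at \<open>v\<close> itself; one factor of the
  squared norm then cancels.\<close>

lemma bessel_imp_bessel_bound:
  assumes "bessel u"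
  obtains B where "bessel_bound B u"
proof -
  obtain B where B: "B > 0" and sm: "\<And>x. (\<lambda>k. (cmod (cinner x (u k)))\<^sup>2) summable_on UNIV"
    and le: "\<And>x. (\<Sum>\<^sub>\<infinity>k. (cmod (cinner x (u k)))\<^sup>2) \<le> B * (norm x)\<^sup>2"
    using assms by (auto simp: bessel_def)
  have "(norm (\<Sum>k\<in>F. c k *\<^sub>C u k))\<^sup>2 \<le> B * (\<Sum>k\<in>F. (cmod (c k))\<^sup>2)" if "finite F" for F c
  proof -
    define v where "v = (\<Sum>k\<in>F. c k *\<^sub>C u k)"
    have "(\<Sum>k\<in>F. (cmod (cinner v (u k)))\<^sup>2) \<le> B * (norm v)\<^sup>2"
      using finite_sum_le_infsum[OF sm that, of v] le[of v] by simp
    then have "(\<Sum>k\<in>F. (cmod (c k))\<^sup>2) * (\<Sum>k\<in>F. (cmod (cinner v (u k)))\<^sup>2)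
        \<le> (\<Sum>k\<in>F. (cmod (c k))\<^sup>2) * (B * (norm v)\<^sup>2)"
      by (intro mult_left_mono) (auto simp: sum_nonneg)
    moreover have "(norm v)\<^sup>2 \<le> (\<Sum>k\<in>F. cmod (c k) * cmod (cinner v (u k)))"
    proof -
      have "(norm v)\<^sup>2 = cmod (cinner v v)"
        by (simp add: cinner_self norm_power)
      also have "cinner v v = (\<Sum>k\<in>F. cnj (c k) * cinner v (u k))"
        by (subst (2) v_def) (simp add: cinner_sum_right cinner_scaleC_right)
      also have "cmod \<dots> \<le> (\<Sum>k\<in>F. cmod (c k) * cmod (cinner v (u k)))"
        by (rule sum_norm_le) (simp add: norm_mult)
      finally show ?thesis .
    qed
    then have "((norm v)\<^sup>2)\<^sup>2 \<le> (\<Sum>k\<in>F. (cmod (c k))\<^sup>2) * (\<Sum>k\<in>F. (cmod (cinner v (u k)))\<^sup>2)"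
      by (intro order.trans[OF power_mono Cauchy_Schwarz_sum]) auto
    ultimately have le: "(norm v)\<^sup>2 * (norm v)\<^sup>2 \<le> (norm v)\<^sup>2 * (B * (\<Sum>k\<in>F. (cmod (c k))\<^sup>2))"
      by (simp add: power2_eq_square ac_simps)
    show ?thesis
    proof (cases "v = 0")
      case False
      then show ?thesis
        unfolding v_def[symmetric] by (intro mult_left_le_imp_le[OF le]) simp
    qed (use B in \<open>simp add: v_def[symmetric] sum_nonneg\<close>)
  qed
  with B show ?thesis
    using that[of B] by (simp add: bessel_bound_def)
qed

text \<open>The converse duality argument takes the coefficients of \<open>x\<close> as
  \<open>c\<close>: a partial sum \<open>s\<close> equals \<open>cinner x v\<close>, so its square
  is at most \<open>B * s\<close> times the squared norm of \<open>x\<close>, and \<open>s\<close>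
  cancels. Bounded nonnegative partial sums converge.\<close>

lemma bessel_bound_imp_bessel:
  assumes "bessel_bound B u"
  shows "bessel u"
proof -
  have B: "B > 0"
    using assms by (simp add: bessel_bound_def)
  have fin: "(\<Sum>k\<in>F. (cmod (cinner x (u k)))\<^sup>2) \<le> B * (norm x)\<^sup>2" if "finite F" for x F
  proof -
    define s where "s = (\<Sum>k\<in>F. (cmod (cinner x (u k)))\<^sup>2)"
    define v where "v = (\<Sum>k\<in>F. cinner x (u k) *\<^sub>C u k)"
    have s: "s \<ge> 0"
      by (simp add: s_def sum_nonneg)
    have "cinner x v = of_real s"
      by (simp add: v_def s_def cinner_sum_right cinner_scaleC_right mult_cnj_cmod
          mult.commute[of "cnj _"])
    then have "s \<le> norm x * norm v"
      using cmod_cinner_le[of x v] s by simp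
    then have "s\<^sup>2 \<le> (norm x)\<^sup>2 * (norm v)\<^sup>2"
      using power_mono[of s "norm x * norm v" 2] s by (simp add: power_mult_distrib)
    also have "\<dots> \<le> (norm x)\<^sup>2 * (B * s)"
      using assms that by (intro mult_left_mono) (auto simp: bessel_bound_def v_def s_def)
    finally have "s * s \<le> s * (B * (norm x)\<^sup>2)"
      by (simp add: power2_eq_square ac_simps)
    then show ?thesis
      using s B unfolding s_def[symmetric] by (cases "s = 0") (auto simp: mult_le_cancel_left)
  qed
  have sm: "(\<lambda>k. (cmod (cinner x (u k)))\<^sup>2) summable_on UNIV" for x
    by (rule nonneg_bdd_above_summable_on) (auto intro!: bdd_aboveI2 fin)
  show ?thesis
    unfolding bessel_def using B sm infsum_le_finite_sums[OF sm fin] by blast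
qed

lemma bessel_coefficients_ell2:
  "bessel u \<Longrightarrow> (\<lambda>k. cinner x (u k)) \<in> ell2"
  by (auto simp: bessel_def ell2_def)

lemma bessel_image:
  assumes "bessel u" "bounded_clinear L"
  shows "bessel (\<lambda>k. L (u k))"
proof -
  obtain B where B: "bessel_bound B u"
    using assms(1) by (rule bessel_imp_bessel_bound)
  obtain K where K: "K > 0" "\<And>x. norm (L x) \<le> K * norm x"
    using assms(2) by (rule bounded_clinear_pos_bounded) blast
  have "(norm (\<Sum>k\<in>F. c k *\<^sub>C L (u k)))\<^sup>2 \<le> K\<^sup>2 * B * (\<Sum>k\<in>F. (cmod (c k))\<^sup>2)" if "finite F" for F c
  proof -
    have "(norm (\<Sum>k\<in>F. c k *\<^sub>C L (u k)))\<^sup>2 = (norm (L (\<Sum>k\<in>F. c k *\<^sub>C u k)))\<^sup>2"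
      using assms(2) by (simp add: bounded_clinear_sum bounded_clinear_scaleC)
    also have "\<dots> \<le> K\<^sup>2 * (norm (\<Sum>k\<in>F. c k *\<^sub>C u k))\<^sup>2"
      unfolding power_mult_distrib[symmetric] by (intro power_mono K) simp
    also have "\<dots> \<le> K\<^sup>2 * (B * (\<Sum>k\<in>F. (cmod (c k))\<^sup>2))"
      using B that by (intro mult_left_mono) (auto simp: bessel_bound_def)
    finally show ?thesis by simp
  qed
  then show ?thesis
    using B K(1) by (intro bessel_bound_imp_bessel[of "K\<^sup>2 * B"]) (simp add: bessel_bound_def)
qed

lemma bessel_add:
  assumes "bessel u" "bessel v"
  shows "bessel (\<lambda>k. u k + v k)"
proof -
  obtain A B where AB: "bessel_bound A u" "bessel_bound B v"
    using assms by (meson bessel_imp_bessel_bound)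
  have "(norm (\<Sum>k\<in>F. c k *\<^sub>C (u k + v k)))\<^sup>2 \<le> (2 * A + 2 * B) * (\<Sum>k\<in>F. (cmod (c k))\<^sup>2)"
    if "finite F" for F c
  proof -
    define x y where "x = (\<Sum>k\<in>F. c k *\<^sub>C u k)" and "y = (\<Sum>k\<in>F. c k *\<^sub>C v k)"
    have "(norm (x + y))\<^sup>2 \<le> (norm x + norm y)\<^sup>2"
      by (intro power_mono norm_triangle_ineq) simp
    \<comment> \<open>The square of \<open>norm x - norm y\<close> is nonnegative; this is the
      source of the constant \<open>2 * A + 2 * B\<close>.\<close>
    also have "\<dots> \<le> 2 * (norm x)\<^sup>2 + 2 * (norm y)\<^sup>2"
      using zero_le_power2[of "norm x - norm y"] by (simp add: power2_sum power2_diff)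
    also have "\<dots> \<le> 2 * (A * (\<Sum>k\<in>F. (cmod (c k))\<^sup>2)) + 2 * (B * (\<Sum>k\<in>F. (cmod (c k))\<^sup>2))"
      using AB that by (intro add_mono mult_left_mono) (auto simp: bessel_bound_def x_def y_def)
    finally show ?thesis
      by (simp add: x_def y_def scaleC_add_right sum.distrib algebra_simps)
  qed
  then show ?thesis
    using AB by (intro bessel_bound_imp_bessel[of "2 * A + 2 * B"]) (auto simp: bessel_bound_def)
qed

lemma bessel_diff:
  assumes "bessel u" "bessel v"
  shows "bessel (\<lambda>k. u k - v k)"
  using bessel_add[OF assms(1) bessel_image[OF assms(2) bounded_clinear_scaleC_const[of "- 1"]]]
  by (simp add: scaleC_minus_one)

lemma bij_int_shift: "bij_betw (\<lambda>k::int. k + j) UNIV UNIV"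
  by (rule bij_betwI[of _ _ _ "\<lambda>k. k - j"]) auto

lemma bessel_shift:
  assumes "bessel u"
  shows "bessel (\<lambda>k. u (k + j))"
proof -
  have "(\<lambda>k. (cmod (cinner x (u (k + j))))\<^sup>2) summable_on UNIV
      \<longleftrightarrow> (\<lambda>k. (cmod (cinner x (u k)))\<^sup>2) summable_on UNIV" for x
    by (rule summable_on_reindex_bij_betw[OF bij_int_shift])
  moreover have "(\<Sum>\<^sub>\<infinity>k. (cmod (cinner x (u (k + j))))\<^sup>2) = (\<Sum>\<^sub>\<infinity>k. (cmod (cinner x (u k)))\<^sup>2)" for x
    by (rule infsum_reindex_bij_betw[OF bij_int_shift])
  ultimately show ?thesis
    using assms unfolding bessel_def by simp
qed

section \<open>Convergence and boundedness of synthesis\<close>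

lemma bessel_has_sum:
  fixes u :: "int \<Rightarrow> 'a::chilbert_space"
  assumes "bessel u" "c \<in> ell2"
  shows "((\<lambda>k. c k *\<^sub>C u k) has_sum synthesis u c) UNIV"
proof -
  obtain B where B: "bessel_bound B u"
    using assms(1) by (rule bessel_imp_bessel_bound)
  define s where "s = (\<Sum>\<^sub>\<infinity>k. (cmod (c k))\<^sup>2)"
  have sm: "(\<lambda>k. (cmod (c k))\<^sup>2) summable_on UNIV"
    using assms(2) by (simp add: ell2_def)
  \<comment> \<open>The partial sums form a Cauchy net: beyond a large \<open>F0\<close>, their
    differences are controlled by the square-summable tail of \<open>c\<close>. Absolute convergence
    is not claimed.\<close>
  have "\<exists>P. eventually P (finite_subsets_at_top UNIV) \<and> (\<forall>F F'. P F \<and> P F' \<longrightarrow>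
      dist (\<Sum>k\<in>F. c k *\<^sub>C u k) (\<Sum>k\<in>F'. c k *\<^sub>C u k) < e)" if "e > 0" for e
  proof -
    \<comment> \<open>Chosen so that \<open>B * d\<close> is the square of \<open>e / 3\<close>: two
      sets containing \<open>F0\<close> are each within \<open>e / 3\<close> of it, hence within
      less than \<open>e\<close> of one another.\<close>
    define d where "d = (e / 3)\<^sup>2 / B"
    have d: "d > 0"
      using \<open>e > 0\<close> B by (simp add: d_def bessel_bound_def)
    obtain F0 where F0: "finite F0" and "dist (\<Sum>k\<in>F0. (cmod (c k))\<^sup>2) s \<le> d"
      using has_sum_finite_approximation[OF has_sum_infsum[OF sm] d] unfolding s_def by blast
    then have s: "s \<le> (\<Sum>k\<in>F0. (cmod (c k))\<^sup>2) + d"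
      by (simp add: dist_real_def)
    have near: "dist (\<Sum>k\<in>F. c k *\<^sub>C u k) (\<Sum>k\<in>F0. c k *\<^sub>C u k) \<le> e / 3"
      if F: "finite F" "F0 \<subseteq> F" for F
    proof (rule power2_le_imp_le)
      have "(\<Sum>k\<in>F - F0. (cmod (c k))\<^sup>2) = (\<Sum>k\<in>F. (cmod (c k))\<^sup>2) - (\<Sum>k\<in>F0. (cmod (c k))\<^sup>2)"
        using F by (simp add: sum_diff)
      also have "\<dots> \<le> d"
        using s finite_sum_le_infsum[OF sm F(1)] unfolding s_def by simp
      finally have tail: "(\<Sum>k\<in>F - F0. (cmod (c k))\<^sup>2) \<le> d" .
      have "(dist (\<Sum>k\<in>F. c k *\<^sub>C u k) (\<Sum>k\<in>F0. c k *\<^sub>C u k))\<^sup>2 = (norm (\<Sum>k\<in>F - F0. c k *\<^sub>C u k))\<^sup>2"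
        using F by (simp add: dist_norm sum_diff)
      also have "\<dots> \<le> B * (\<Sum>k\<in>F - F0. (cmod (c k))\<^sup>2)"
        using B F by (simp add: bessel_bound_def)
      also have "\<dots> \<le> B * d"
        using B tail by (simp add: bessel_bound_def)
      also have "\<dots> = (e / 3)\<^sup>2"
        using B by (simp add: d_def bessel_bound_def)
      finally show "(dist (\<Sum>k\<in>F. c k *\<^sub>C u k) (\<Sum>k\<in>F0. c k *\<^sub>C u k))\<^sup>2 \<le> (e / 3)\<^sup>2" .
    qed (use \<open>e > 0\<close> in simp)
    have "eventually (\<lambda>F. finite F \<and> F0 \<subseteq> F) (finite_subsets_at_top UNIV)"
      using F0 by (auto simp: eventually_finite_subsets_at_top)
    moreover have "dist (\<Sum>k\<in>F. c k *\<^sub>C u k) (\<Sum>k\<in>F'. c k *\<^sub>C u k) < e"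
      if "finite F" "F0 \<subseteq> F" "finite F'" "F0 \<subseteq> F'" for F F'
      using near[OF that(1,2)] near[OF that(3,4)] \<open>e > 0\<close>
        dist_triangle2[of "\<Sum>k\<in>F. c k *\<^sub>C u k" "\<Sum>k\<in>F'. c k *\<^sub>C u k" "\<Sum>k\<in>F0. c k *\<^sub>C u k"]
      by linarith
    ultimately show ?thesis
      by blast
  qed
  then have "cauchy_filter (filtermap (\<lambda>F. \<Sum>k\<in>F. c k *\<^sub>C u k) (finite_subsets_at_top UNIV))"
    by (simp add: cauchy_filter_metric_filtermap)
  then obtain l where "((\<lambda>F. \<Sum>k\<in>F. c k *\<^sub>C u k) \<longlongrightarrow> l) (finite_subsets_at_top UNIV)"
    using complete_uniform[where S="UNIV::'a set"] complete_UNIV by (force simp add: filterlim_def)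
  then have "(\<lambda>k. c k *\<^sub>C u k) summable_on UNIV"
    by (auto simp: has_sum_def summable_on_def)
  then show ?thesis
    unfolding synthesis_def by (rule has_sum_infsum)
qed

lemma bessel_bound_norm_synthesis:
  fixes u :: "int \<Rightarrow> 'a::chilbert_space"
  assumes "bessel_bound B u" "c \<in> ell2"
  shows "(norm (synthesis u c))\<^sup>2 \<le> B * (\<Sum>\<^sub>\<infinity>k. (cmod (c k))\<^sup>2)"
proof (rule tendsto_upperbound)
  have "bessel u"
    using assms(1) by (rule bessel_bound_imp_bessel)
  then show "((\<lambda>F. (norm (\<Sum>k\<in>F. c k *\<^sub>C u k))\<^sup>2) \<longlongrightarrow> (norm (synthesis u c))\<^sup>2) (finite_subsets_at_top UNIV)"
    using bessel_has_sum[of u c] assms(2) unfolding has_sum_def by (intro tendsto_intros)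
  have "(norm (\<Sum>k\<in>F. c k *\<^sub>C u k))\<^sup>2 \<le> B * (\<Sum>\<^sub>\<infinity>k. (cmod (c k))\<^sup>2)" if "finite F" for F
  proof -
    have "(norm (\<Sum>k\<in>F. c k *\<^sub>C u k))\<^sup>2 \<le> B * (\<Sum>k\<in>F. (cmod (c k))\<^sup>2)"
      using assms(1) that by (simp add: bessel_bound_def)
    also have "\<dots> \<le> B * (\<Sum>\<^sub>\<infinity>k. (cmod (c k))\<^sup>2)"
      using assms that
      by (intro mult_left_mono finite_sum_le_infsum) (auto simp: bessel_bound_def ell2_def)
    finally show ?thesis .
  qed
  then show "eventually (\<lambda>F. (norm (\<Sum>k\<in>F. c k *\<^sub>C u k))\<^sup>2 \<le> B * (\<Sum>\<^sub>\<infinity>k. (cmod (c k))\<^sup>2))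
      (finite_subsets_at_top UNIV)"
    by (auto intro: eventually_finite_subsets_at_top_weakI)
qed (rule finite_subsets_at_top_neq_bot)

lemma has_sum_cinner_synthesis:
  fixes u :: "int \<Rightarrow> 'a::chilbert_space"
  assumes "bessel u" "c \<in> ell2"
  shows "((\<lambda>k. c k * cinner (u k) y) has_sum cinner (synthesis u c) y) UNIV"
  using has_sum_bounded_linear[OF bounded_linear_cinner_left bessel_has_sum[OF assms]]
  by (simp add: cinner_scaleC_left)

section \<open>Mixed operators of two Bessel families\<close>

text \<open>Frame operators are the case \<open>u = v\<close>, and duality of \<open>g\<close> to \<open>f\<close> says \<open>mixed_operator g f = id\<close>.\<close>

definition mixed_operator :: "(int \<Rightarrow> 'a::complex_inner) \<Rightarrow> (int \<Rightarrow> 'b::complex_inner) \<Rightarrow> 'a \<Rightarrow> 'b"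
  where "mixed_operator u v x = synthesis v (\<lambda>k. cinner x (u k))"

lemma mixed_operator_has_sum:
  fixes v :: "int \<Rightarrow> 'b::chilbert_space"
  assumes "bessel u" "bessel v"
  shows "((\<lambda>k. cinner x (u k) *\<^sub>C v k) has_sum mixed_operator u v x) UNIV"
  unfolding mixed_operator_def by (intro bessel_has_sum bessel_coefficients_ell2 assms)

lemma mixed_operator_eqI:
  fixes v :: "int \<Rightarrow> 'b::chilbert_space"
  assumes "((\<lambda>k. cinner x (u k) *\<^sub>C v k) has_sum y) UNIV"
  shows "mixed_operator u v x = y"
  unfolding mixed_operator_def synthesis_def using assms by (rule infsumI)

text \<open>Both sides are the sum of the same series
  \<open>cinner x (u k) * cinner (v k) y\<close>, so swapping the families is taking the
  adjoint.\<close>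

lemma cinner_mixed_operator:
  fixes u :: "int \<Rightarrow> 'a::chilbert_space" and v :: "int \<Rightarrow> 'b::chilbert_space"
  assumes "bessel u" "bessel v"
  shows "cinner (mixed_operator u v x) y = cinner x (mixed_operator v u y)"
proof -
  have "((\<lambda>k. cinner x (u k) * cinner (v k) y) has_sum cinner (mixed_operator u v x) y) UNIV"
    using has_sum_bounded_linear[OF bounded_linear_cinner_left mixed_operator_has_sum[OF assms]]
    by (simp add: cinner_scaleC_left)
  moreover have "((\<lambda>k. cinner x (u k) * cinner (v k) y) has_sum cinner x (mixed_operator v u y)) UNIV"
    using has_sum_bounded_linear[OF bounded_linear_cinner_right mixed_operator_has_sum[OF assms(2,1)], of x y]
    by (simp add: cinner_scaleC_right cinner_commute[of y "v _"] mult.commute)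
  ultimately show ?thesis
    by (rule has_sum_unique)
qed

lemma bounded_clinear_mixed_operator:
  fixes u :: "int \<Rightarrow> 'a::chilbert_space" and v :: "int \<Rightarrow> 'b::chilbert_space"
  assumes "bessel u" "bessel v"
  shows "bounded_clinear (mixed_operator u v)"
proof -
  obtain A where A: "A > 0" "\<And>x. (\<Sum>\<^sub>\<infinity>k. (cmod (cinner x (u k)))\<^sup>2) \<le> A * (norm x)\<^sup>2"
    using assms(1) by (auto simp: bessel_def)
  obtain B where B: "bessel_bound B v"
    using assms(2) by (rule bessel_imp_bessel_bound)
  have B0: "B > 0"
    using B by (simp add: bessel_bound_def)
  note hs = mixed_operator_has_sum[OF assms]
  show ?thesis
  proof (rule bounded_clinearI)
    show "mixed_operator u v (x + y) = mixed_operator u v x + mixed_operator u v y" for x y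
      using has_sum_add[OF hs[of x] hs[of y]]
      by (intro mixed_operator_eqI) (simp add: cinner_add_left scaleC_add_left)
    show "mixed_operator u v (a *\<^sub>C x) = a *\<^sub>C mixed_operator u v x" for a x
      using has_sum_bounded_linear[OF
          bounded_clinear_bounded_linear[OF bounded_clinear_scaleC_const] hs[of x]]
      by (intro mixed_operator_eqI) (simp add: cinner_scaleC_left scaleC_scaleC)
    show "norm (mixed_operator u v x) \<le> sqrt (B * A) * norm x" for x
    proof (rule power2_le_imp_le)
      have "(norm (mixed_operator u v x))\<^sup>2 \<le> B * (\<Sum>\<^sub>\<infinity>k. (cmod (cinner x (u k)))\<^sup>2)"
        unfolding mixed_operator_def
        by (intro bessel_bound_norm_synthesis B bessel_coefficients_ell2 assms)
      also have "\<dots> \<le> B * (A * (norm x)\<^sup>2)"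
        using A B0 by simp
      also have "\<dots> = (sqrt (B * A) * norm x)\<^sup>2"
        using A(1) B0 by (simp add: power_mult_distrib)
      finally show "(norm (mixed_operator u v x))\<^sup>2 \<le> (sqrt (B * A) * norm x)\<^sup>2" .
    qed (use A(1) B0 in simp)
  qed
qed

lemma mixed_operator_image_right:
  fixes u :: "int \<Rightarrow> 'a::chilbert_space" and v :: "int \<Rightarrow> 'b::chilbert_space"
    and L :: "'b \<Rightarrow> 'c::chilbert_space"
  assumes "bessel u" "bessel v" "bounded_clinear L"
  shows "mixed_operator u (\<lambda>k. L (v k)) x = L (mixed_operator u v x)"
  using has_sum_bounded_linear[OF bounded_clinear_bounded_linear[OF assms(3)]
      mixed_operator_has_sum[OF assms(1,2)]]
  by (intro mixed_operator_eqI) (simp add: bounded_clinear_scaleC[OF assms(3)])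

lemma mixed_operator_image_left:
  assumes "\<And>x y. cinner (L x) y = cinner x (M y)"
  shows "mixed_operator (\<lambda>k. M (u k)) v x = mixed_operator u v (L x)"
  by (simp add: mixed_operator_def assms)

lemma mixed_operator_shift:
  "mixed_operator (\<lambda>k. u (k + j)) (\<lambda>k. v (k + j)) x = mixed_operator u v x"
  unfolding mixed_operator_def synthesis_def
  by (rule infsum_reindex_bij_betw[OF bij_int_shift])

text \<open>Swapping the families is taking the adjoint, and the identity is its own
  adjoint.\<close>

lemma mixed_operator_swap_id:
  fixes u v :: "int \<Rightarrow> 'a::chilbert_space"
  assumes "bessel u" "bessel v" "\<And>x. mixed_operator u v x = x"
  shows "mixed_operator v u x = x"
  by (rule cinner_eqI) (simp add: cinner_mixed_operator[OF assms(1,2), symmetric] assms(3))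

section \<open>Frames\<close>

lemma ell2_inner_delta: "ell2_inner (\<lambda>k. if k = j then 1 else 0) d = cnj (d j)"
proof -
  have "ell2_inner (\<lambda>k. if k = j then 1 else 0) d = (\<Sum>\<^sub>\<infinity>k\<in>{j}. cnj (d k))"
    unfolding ell2_inner_def by (rule infsum_cong_neutral) auto
  then show ?thesis
    by simp
qed

lemma delta_ell2: "(\<lambda>k. if k = j then 1 else 0) \<in> ell2"
proof -
  have "(\<lambda>k. (cmod (if k = j then 1 else 0))\<^sup>2) summable_on {j}"
    by simp
  then show ?thesis
    unfolding ell2_def mem_Collect_eq
    by (subst summable_on_cong_neutral[where T = "{j}"]) auto
qed

text \<open>The analysis coefficients satisfy the adjoint relation; testing against unit sequences
  shows that no other sequence does, which settles the definite description.\<close>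

lemma synthesis_adjoint_eq:
  fixes u :: "int \<Rightarrow> 'a::chilbert_space"
  assumes "bessel u"
  shows "synthesis_adjoint u x = (\<lambda>k. cinner x (u k))"
  unfolding synthesis_adjoint_def
proof (rule the_equality, intro conjI ballI)
  show "(\<lambda>k. cinner x (u k)) \<in> ell2"
    by (rule bessel_coefficients_ell2[OF assms])
  show *: "cinner (synthesis u c) x = ell2_inner c (\<lambda>k. cinner x (u k))" if "c \<in> ell2" for c
    using infsumI[OF has_sum_cinner_synthesis[OF assms that, of x]]
    by (simp add: ell2_inner_def cinner_commute[of "u _" x])
  fix d assume d: "d \<in> ell2 \<and> (\<forall>c\<in>ell2. cinner (synthesis u c) x = ell2_inner c d)"
  show "d = (\<lambda>k. cinner x (u k))"
  proof
    fix j
    show "d j = cinner x (u j)"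
      using d *[OF delta_ell2[of j]] delta_ell2[of j] by (simp add: ell2_inner_delta)
  qed
qed

lemma frame_operator_eq:
  fixes u :: "int \<Rightarrow> 'a::chilbert_space"
  assumes "bessel u"
  shows "frame_operator u = mixed_operator u u"
  by (simp add: fun_eq_iff frame_operator_def mixed_operator_def synthesis_adjoint_eq[OF assms])

text \<open>The lower bound comes from \<open>f\<close>: each \<open>x\<close> is synthesised by
  \<open>f\<close> from its \<open>g\<close> coefficients, so the bound \<open>B\<close> of that
  synthesis yields the lower constant \<open>1 / B\<close>.\<close>

lemma is_frameI_dual:
  fixes f g :: "int \<Rightarrow> 'a::chilbert_space"
  assumes "bessel f" "bessel g" "\<And>x. mixed_operator g f x = x"
  shows "is_frame g"
proof -
  obtain B where B: "bessel_bound B f"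
    using assms(1) by (rule bessel_imp_bessel_bound)
  have "(1 / B) * (norm x)\<^sup>2 \<le> (\<Sum>\<^sub>\<infinity>k. (cmod (cinner x (g k)))\<^sup>2)" for x
    using bessel_bound_norm_synthesis[OF B bessel_coefficients_ell2[OF assms(2)], of x] assms(3)[of x] B
    by (simp add: mixed_operator_def bessel_bound_def field_simps)
  moreover have "1 / B > 0"
    using B by (simp add: bessel_bound_def)
  ultimately show ?thesis
    using assms(2) unfolding is_frame_def by blast
qed

lemma dual_frame_iff:
  fixes f g :: "int \<Rightarrow> 'a::chilbert_space"
  assumes "bessel f"
  shows "dual_frame f g \<longleftrightarrow> bessel g \<and> (\<forall>x. mixed_operator g f x = x)"
proof
  assume "dual_frame f g"
  then show "bessel g \<and> (\<forall>x. mixed_operator g f x = x)"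
    unfolding dual_frame_def is_frame_def using mixed_operator_eqI by blast
next
  assume *: "bessel g \<and> (\<forall>x. mixed_operator g f x = x)"
  then have "((\<lambda>k. cinner x (g k) *\<^sub>C f k) has_sum x) UNIV" for x
    using mixed_operator_has_sum[OF _ assms, of g x] by simp
  then show "dual_frame f g"
    using * is_frameI_dual[OF assms] by (auto simp: dual_frame_def)
qed

section \<open>Invertibility of the frame operator\<close>

text \<open>Since \<open>A \<parallel>x\<parallel>\<^sup>2 \<le> \<langle>S x, x\<rangle>\<close> and \<open>\<parallel>S x\<parallel> \<le> C \<parallel>x\<parallel>\<close>, the map \<open>x \<mapsto> x - t S x\<close> with \<open>t = A / C\<^sup>2\<close>
  is a contraction, so Banach's fixed point theorem solves \<open>S x = y\<close>.\<close>

lemma bij_frame_operator: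
  fixes f :: "int \<Rightarrow> 'a::chilbert_space"
  assumes "is_frame f"
  shows "bij (frame_operator f)"
    and "bounded_clinear (inv (frame_operator f))"
proof -
  define S where "S = frame_operator f"
  have bf: "bessel f"
    using assms by (simp add: is_frame_def)
  have S: "S = mixed_operator f f"
    unfolding S_def by (rule frame_operator_eq[OF bf])
  have lin: "bounded_clinear S"
    unfolding S by (rule bounded_clinear_mixed_operator[OF bf bf])
  obtain A where A: "A > 0" "\<And>x. A * (norm x)\<^sup>2 \<le> (\<Sum>\<^sub>\<infinity>k. (cmod (cinner x (f k)))\<^sup>2)"
    using assms by (auto simp: is_frame_def)
  \<comment> \<open>The inner product of \<open>S x\<close> and \<open>x\<close> is the sum of
    squared coefficients, so the lower frame bound is coercivity of \<open>S\<close>.\<close>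
  have pos: "A * (norm x)\<^sup>2 \<le> Re (cinner (S x) x)" for x
  proof -
    have "((\<lambda>k. cinner x (f k) * cinner (f k) x) has_sum cinner (S x) x) UNIV"
      unfolding S mixed_operator_def by (intro has_sum_cinner_synthesis bf bessel_coefficients_ell2)
    then have "((\<lambda>k. complex_of_real ((cmod (cinner x (f k)))\<^sup>2)) has_sum cinner (S x) x) UNIV"
      by (simp only: cinner_commute[of "f _" x] complex_norm_square)
    from has_sum_Re[OF this] have "(\<Sum>\<^sub>\<infinity>k. (cmod (cinner x (f k)))\<^sup>2) = Re (cinner (S x) x)"
      by (simp add: infsumI del: of_real_power)
    with A(2)[of x] show ?thesis by simp
  qed
  obtain K where K: "K > 0" "\<And>x. norm (S x) \<le> K * norm x"
    using lin by (rule bounded_clinear_pos_bounded) blast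
  \<comment> \<open>Adding \<open>A\<close> forces \<open>A < C\<close>, which keeps the radicand of
    \<open>q\<close> positive.\<close>
  define C where "C = K + A"
  have C: "C > 0" "A < C"
    using K A by (auto simp: C_def)
  have bdd: "norm (S x) \<le> C * norm x" for x
    using K(2)[of x] mult_right_mono[of K C "norm x"] A by (simp add: C_def)
  \<comment> \<open>This \<open>t\<close> minimises
    \<open>1 - 2 * t * A + t\<^sup>2 * C\<^sup>2\<close>, and the minimum is
    \<open>q\<^sup>2\<close>.\<close>
  define t where "t = A / C\<^sup>2"
  define q where "q = sqrt (1 - (A / C)\<^sup>2)"
  have AC: "0 < A / C" "A / C < 1"
    using A C by auto
  then have sq: "0 < (A / C)\<^sup>2" "(A / C)\<^sup>2 < 1"
    using power_strict_mono[of "A / C" 1 2] by (auto simp del: divide_less_eq_1_pos)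
  then have q: "0 \<le> q" "q < 1" "q\<^sup>2 = 1 - (A / C)\<^sup>2"
    by (auto simp: q_def)
  have t: "t > 0"
    using A C by (simp add: t_def)
  have contr: "norm (x - t *\<^sub>R S x) \<le> q * norm x" for x
  proof (rule power2_le_imp_le)
    have "(norm (x - t *\<^sub>R S x))\<^sup>2 = Re (cinner (x - t *\<^sub>R S x) (x - t *\<^sub>R S x))"
      by (simp only: cinner_self Re_complex_of_real)
    also have "cinner (x - t *\<^sub>R S x) (x - t *\<^sub>R S x)
        = cinner x x - t * cinner x (S x) - t * cinner (S x) x + t\<^sup>2 * cinner (S x) (S x)"
      by (simp only: scaleR_scaleC cinner_diff_left cinner_diff_right cinner_scaleC_left
          cinner_scaleC_right) (simp add: algebra_simps power2_eq_square)
    also have "Re \<dots> = (norm x)\<^sup>2 - 2 * t * Re (cinner (S x) x) + t\<^sup>2 * (norm (S x))\<^sup>2"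
      by (simp add: cinner_self cinner_commute[of x "S x"] power2_eq_square)
    also have "\<dots> \<le> (norm x)\<^sup>2 - 2 * t * (A * (norm x)\<^sup>2) + t\<^sup>2 * (C * norm x)\<^sup>2"
      using t pos[of x] by (intro add_mono diff_mono mult_left_mono power_mono bdd) auto
    also have "\<dots> = (1 - (A / C)\<^sup>2) * (norm x)\<^sup>2"
      using C by (simp add: t_def field_simps power2_eq_square)
    also have "\<dots> = (q * norm x)\<^sup>2"
      by (simp add: power_mult_distrib q)
    finally show "(norm (x - t *\<^sub>R S x))\<^sup>2 \<le> (q * norm x)\<^sup>2" .
  qed (use q in simp)
  have ex1: "\<exists>!x. S x = y" for y
  proof -
    \<comment> \<open>Translation by \<open>t *\<^sub>R y\<close> leaves the contraction constant
      unchanged and turns fixed points into solutions of \<open>S x = y\<close>.\<close>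
    have "\<exists>!x. x - t *\<^sub>R S x + t *\<^sub>R y = x"
    proof (rule banach_fix_type[OF q(1,2)], intro allI)
      fix x z
      have "(x - t *\<^sub>R S x + t *\<^sub>R y) - (z - t *\<^sub>R S z + t *\<^sub>R y) = (x - z) - t *\<^sub>R S (x - z)"
        by (simp add: bounded_clinear_diff[OF lin] scaleR_diff_right)
      then show "dist (x - t *\<^sub>R S x + t *\<^sub>R y) (z - t *\<^sub>R S z + t *\<^sub>R y) \<le> q * dist x z"
        using contr[of "x - z"] by (simp only: dist_norm)
    qed
    moreover have "x - t *\<^sub>R S x + t *\<^sub>R y = x \<longleftrightarrow> S x = y" for x
      using t by (auto simp: algebra_simps)
    ultimately show ?thesis
      by simp
  qed
  have bij: "bij S"
    using ex1 by (auto simp: bij_iff)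
  then show "bij (frame_operator f)"
    by (simp add: S_def)
  have SI: "S (inv S y) = y" for y
    using bij by (simp add: bij_is_surj surj_f_inv_f)
  have IS: "inv S (S x) = x" for x
    using bij by (simp add: bij_is_inj)
  have "bounded_clinear (inv S)"
  proof (rule bounded_clinearI)
    show "inv S (x + y) = inv S x + inv S y" for x y
      by (metis IS SI bounded_clinear_add[OF lin])
    show "inv S (a *\<^sub>C x) = a *\<^sub>C inv S x" for a x
      by (metis IS SI bounded_clinear_scaleC[OF lin])
    show "norm (inv S y) \<le> (1 / A) * norm y" for y
    proof -
      define x where "x = inv S y"
      \<comment> \<open>Coercivity and Cauchy-Schwarz together; dividing by \<open>norm x\<close>
        bounds the inverse by \<open>1 / A\<close>.\<close>
      have "A * (norm x)\<^sup>2 \<le> norm (S x) * norm x"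
        using pos[of x] complex_Re_le_cmod[of "cinner (S x) x"] cmod_cinner_le[of "S x" x]
        by linarith
      then have "norm x * (A * norm x) \<le> norm x * norm (S x)"
        by (simp add: power2_eq_square ac_simps)
      then have "A * norm x \<le> norm (S x)"
        by (cases "x = 0") auto
      then show ?thesis
        using A(1) by (simp add: x_def SI field_simps)
    qed
  qed
  then show "bounded_clinear (inv (frame_operator f))"
    by (simp add: S_def)
qed

text \<open>Applying the inverse frame operator termwise to the series of
  \<open>frame_operator f x\<close> gives the first expansion; the second is its adjoint.\<close>

lemma frame_expansion:
  fixes f :: "int \<Rightarrow> 'a::chilbert_space"
  assumes "is_frame f"
  shows "mixed_operator f (\<lambda>k. inv (frame_operator f) (f k)) x = x"
    and "mixed_operator (\<lambda>k. inv (frame_operator f) (f k)) f x = x"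
proof -
  have f: "bessel f"
    using assms by (simp add: is_frame_def)
  note D = bij_frame_operator[OF assms]
  have "inv (frame_operator f) (frame_operator f x) = x" for x
    using D(1) by (simp add: bij_is_inj)
  then show *: "mixed_operator f (\<lambda>k. inv (frame_operator f) (f k)) x = x" for x
    using mixed_operator_image_right[OF f f D(2)] by (simp add: frame_operator_eq[OF f])
  show "mixed_operator (\<lambda>k. inv (frame_operator f) (f k)) f x = x"
    by (rule mixed_operator_swap_id[OF f bessel_image[OF f D(2)] *])
qed

text \<open>The frame expansion makes Riesz' representation theorem unnecessary: \<open>L\<close> is the mixed operator
  of \<open>f\<close> and \<open>L (S\<inverse> f k)\<close>, whose adjoint is explicit.\<close>

lemma cinner_cadjoint:
  fixes f :: "int \<Rightarrow> 'a::chilbert_space" and L :: "'a \<Rightarrow> 'b::chilbert_space"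
  assumes "is_frame f" "bounded_clinear L"
  shows "cinner (L x) y = cinner x (cadjoint L y)"
proof -
  define d where "d k = inv (frame_operator f) (f k)" for k
  have f: "bessel f" and d: "bessel d"
    using assms(1) bessel_image[OF _ bij_frame_operator(2)[OF assms(1)], of f]
    by (simp_all add: is_frame_def d_def[abs_def])
  have "cinner (L x) y = cinner x (mixed_operator (\<lambda>k. L (d k)) f y)" for x y
    using cinner_mixed_operator[OF f bessel_image[OF d assms(2)], of x y]
      mixed_operator_image_right[OF f d assms(2), of x] frame_expansion(1)[OF assms(1), of x]
    by (simp add: d_def[abs_def])
  then show ?thesis
    using cadjoint_eqI by metis
qed

section \<open>Two-sided orbits\<close>

text \<open>Induction in both directions from 0; the backward step cancels \<open>V\<close> by
  injectivity on \<open>W\<close>.\<close>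

lemma int_orbit_unique:
  fixes g h :: "int \<Rightarrow> 'a"
  assumes "inj_on V W" "\<And>k. g k \<in> W" "\<And>k. h k \<in> W"
    and "\<And>k. g (k + 1) = V (g k)" "\<And>k. h (k + 1) = V (h k)" "g 0 = h 0"
  shows "g = h"
proof
  fix k
  show "g k = h k"
  proof (induction k rule: int_induct[where k = 0])
    case (step2 i)
    have "V (g (i - 1)) = V (h (i - 1))"
      using assms(4,5)[of "i - 1"] step2 by simp
    then show ?case
      using assms(1-3) by (meson inj_onD)
  qed (use assms in auto)
qed

lemma int_iter_on_0 [simp]: "int_iter_on W V 0 x = x"
  by (simp add: int_iter_on_def)

lemma int_iter_on_mem_step:
  assumes "bij_betw V W W" "x \<in> W"
  shows "int_iter_on W V k x \<in> W" "int_iter_on W V (k + 1) x = V (int_iter_on W V k x)"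
proof -
  have pos: "(V ^^ n) x \<in> W" for n
    by (induction n) (use assms in \<open>auto simp: bij_betw_def\<close>)
  have neg: "(inv_into W V ^^ n) x \<in> W" for n
    by (induction n) (use assms in \<open>auto simp: bij_betw_def inv_into_into\<close>)
  show "int_iter_on W V k x \<in> W"
    by (simp add: int_iter_on_def pos neg)
  show "int_iter_on W V (k + 1) x = V (int_iter_on W V k x)"
  proof (cases "0 \<le> k")
    case True
    then show ?thesis
      by (simp add: int_iter_on_def nat_add_distrib)
  next
    case False
    \<comment> \<open>Going from \<open>k\<close> to \<open>k + 1\<close> lowers the exponent of the
      inverse from \<open>Suc n\<close> to \<open>n\<close>, so \<open>V\<close> undoes exactly one
      inverse.\<close>
    define n where "n = nat (- (k + 1))"
    have k: "nat (- k) = Suc n" "k + 1 = - int n"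
      using False by (auto simp: n_def)
    have "int_iter_on W V k x = inv_into W V ((inv_into W V ^^ n) x)"
      using False by (simp add: int_iter_on_def k)
    moreover have "V \<dots> = (inv_into W V ^^ n) x"
      using assms(1) neg by (simp add: bij_betw_def f_inv_into_f)
    \<comment> \<open>For \<open>n = 0\<close> the new index 0 falls into the nonnegative branch of
      \<open>int_iter_on\<close>; both sides are then \<open>x\<close>.\<close>
    moreover have "int_iter_on W V (k + 1) x = (inv_into W V ^^ n) x"
      by (cases "n = 0") (simp_all add: int_iter_on_def k)
    ultimately show ?thesis
      by simp
  qed
qed

lemma int_iter_on_eqI:
  assumes "bij_betw V W W" "\<And>k. g k \<in> W" "\<And>k. g (k + 1) = V (g k)"
  shows "g = (\<lambda>k. int_iter_on W V k (g 0))"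
  by (rule int_orbit_unique[of V W])
    (use assms in \<open>auto simp: int_iter_on_mem_step bij_betw_imp_inj_on\<close>)

section \<open>Frames of iterates\<close>

text \<open>The orbit enters through its one-step recursion and the inverse through
  \<open>T'\<close>, so that index shifts replace computations with integer powers.\<close>

locale iterated_frame =
  fixes T T' :: "'a::chilbert_space \<Rightarrow> 'a" and f :: "int \<Rightarrow> 'a"
  assumes T: "bounded_clinear T" and T': "bounded_clinear T'"
    and TT' [simp]: "T (T' x) = x" and T'T [simp]: "T' (T x) = x"
    and f_step: "f (k + 1) = T (f k)"
    and frame: "is_frame f"
begin

section \<open>Orbits of the inverse adjoint\<close>

text \<open>\<open>R\<close> is the inverse of \<open>T\<^sup>*\<close>, \<open>r h\<close> is the family \<open>(T\<^sup>*)\<^bsup>-k\<^esup> h\<close>, and \<open>D\<close> is \<open>S\<inverse>\<close>.\<close>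

definition R :: "'a \<Rightarrow> 'a"
  where "R = cadjoint T'"

definition r :: "'a \<Rightarrow> int \<Rightarrow> 'a"
  where "r h k = int_iter (cadjoint T) (- k) h"

definition D :: "'a \<Rightarrow> 'a"
  where "D = inv (frame_operator f)"

lemma bessel_f: "bessel f"
  using frame by (simp add: is_frame_def)

lemma T'_f: "T' (f (k + 1)) = f k"
  by (simp add: f_step)

lemma cinner_T: "cinner (T x) y = cinner x (cadjoint T y)"
  by (rule cinner_cadjoint[OF frame T])

lemma cinner_R: "cinner (R x) y = cinner x (T' y)"
  by (metis R_def cinner_cadjoint[OF frame T'] cinner_commute)

lemma cadjoint_R: "cadjoint T (R x) = x" and R_cadjoint: "R (cadjoint T x) = x"
  by (rule cinner_eqI, simp add: R_def cinner_cadjoint[OF frame T', symmetric] cinner_T[symmetric])+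

lemma bounded_clinear_R: "bounded_clinear R"
  unfolding R_def by (rule bounded_clinear_adjoint[OF T' cinner_cadjoint[OF frame T']])

lemma inj_R: "inj R"
  by (metis cadjoint_R injI)

lemma bij_cadjoint: "bij (cadjoint T)"
  by (rule bijI') (metis R_cadjoint, metis cadjoint_R)

lemma r_0 [simp]: "r h 0 = h"
  by (simp add: r_def)

lemma r_step: "r h (k + 1) = R (r h k)"
proof -
  \<comment> \<open>The exponent in \<open>r\<close> is negated, so a step of
    \<open>cadjoint T\<close> leads from index \<open>k + 1\<close> back to
    \<open>k\<close>.\<close>
  have "r h k = cadjoint T (r h (k + 1))"
    using int_iter_on_mem_step(2)[OF bij_cadjoint UNIV_I, of "- (k + 1)" h] by (simp add: r_def)
  then show ?thesis
    by (simp add: R_cadjoint)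
qed

text \<open>As \<open>R\<close> is injective, its orbits are fixed by their value at 0; identities
  between families thus reduce to checking one step.\<close>

lemma r_eqI: "(\<And>k. g (k + 1) = R (g k)) \<Longrightarrow> g = r (g 0)"
  by (rule int_orbit_unique[of R UNIV]) (use inj_R r_step in auto)

lemma r_add: "r (h + h') = (\<lambda>k. r h k + r h' k)"
  using r_eqI[of "\<lambda>k. r h k + r h' k"] by (simp add: r_step bounded_clinear_add[OF bounded_clinear_R])

lemma r_scaleC: "r (a *\<^sub>C h) = (\<lambda>k. a *\<^sub>C r h k)"
  using r_eqI[of "\<lambda>k. a *\<^sub>C r h k"] by (simp add: r_step bounded_clinear_scaleC[OF bounded_clinear_R])

lemma r_r: "r (r h j) = (\<lambda>k. r h (k + j))"
proof -
  have "r h (k + 1 + j) = R (r h (k + j))" for k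
    using r_step[of h "k + j"] by (simp add: ac_simps)
  then show ?thesis
    using r_eqI[of "\<lambda>k. r h (k + j)"] by simp
qed

text \<open>\<open>R\<close> is the adjoint of \<open>T'\<close>, which moves \<open>f\<close> down
  by one index; reindexing transfers the shift to \<open>u\<close>.\<close>

lemma mixed_operator_R: "mixed_operator f u (R x) = mixed_operator f (\<lambda>k. u (k + 1)) x"
proof -
  have "mixed_operator f u (R x) = mixed_operator (\<lambda>k. T' (f k)) u x"
    by (rule mixed_operator_image_left[symmetric, OF cinner_R])
  also have "\<dots> = mixed_operator (\<lambda>k. T' (f (k + 1))) (\<lambda>k. u (k + 1)) x"
    by (rule mixed_operator_shift[symmetric])
  finally show ?thesis
    by (simp add: T'_f)
qed

text \<open>The shift produced by \<open>mixed_operator_R\<close> acts on the orbit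
  \<open>r h\<close> as \<open>R\<close>, which can be taken out of the series.\<close>

lemma mixed_operator_r_commute:
  assumes "bessel (r h)"
  shows "mixed_operator f (r h) (R x) = R (mixed_operator f (r h) x)"
  by (simp add: mixed_operator_R r_step
      mixed_operator_image_right[OF bessel_f assms bounded_clinear_R])

lemma bounded_clinear_D: "bounded_clinear D"
  unfolding D_def by (rule bij_frame_operator[OF frame])

lemma R_D: "R (D x) = D (T x)"
proof -
  have S: "mixed_operator f f (D y) = y" "D (mixed_operator f f y) = y" for y
    using bij_frame_operator(1)[OF frame] unfolding D_def frame_operator_eq[OF bessel_f, symmetric]
    by (simp_all add: bij_is_inj bij_is_surj surj_f_inv_f)
  \<comment> \<open>The relation \<open>S R = T S\<close> at the point \<open>D x\<close>, where the
    right-hand side becomes \<open>T x\<close>.\<close>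
  have "mixed_operator f f (R (D x)) = T (mixed_operator f f (D x))"
    by (simp add: mixed_operator_R f_step mixed_operator_image_right[OF bessel_f bessel_f T])
  then show ?thesis
    by (metis S)
qed

lemma r_D: "r (D (f 0)) = (\<lambda>k. D (f k))"
  using r_eqI[of "\<lambda>k. D (f k)"] by (simp add: R_D f_step)

lemma bessel_r_D: "bessel (r (D (f 0)))"
  unfolding r_D by (rule bessel_image[OF bessel_f bounded_clinear_D])

lemma mixed_operator_r_D:
  "mixed_operator f (r (D (f 0))) x = x" "mixed_operator (r (D (f 0))) f x = x"
  using frame_expansion[OF frame, of x] by (simp_all add: r_D D_def[symmetric])

section \<open>Characterisation of the dual frames given by iterates\<close>

lemma bounded_iterates_r: "bounded_iterates (r g0)"
proof -
  let ?W = "cspan (range (r g0))"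
  \<comment> \<open>\<open>R\<close> shifts the two-sided orbit, and a shift permutes the integers;
    hence \<open>R\<close> maps the span onto itself and serves as the witness
    \<open>V\<close>.\<close>
  have "R ` range (r g0) = range (r g0)"
  proof -
    have "R ` range (r g0) = range (\<lambda>k. r g0 (k + 1))"
      by (auto simp: r_step)
    also have "\<dots> = r g0 ` range (\<lambda>k. k + 1)"
      by (simp only: image_image)
    also have "range (\<lambda>k::int. k + 1) = UNIV"
      by (rule bij_is_surj[OF bij_int_shift])
    finally show ?thesis .
  qed
  then have bij: "bij_betw R ?W ?W"
    using inj_R
    by (auto simp: bij_betw_def bounded_clinear_span_image[OF bounded_clinear_R] intro: inj_on_subset)
  have "r g0 k = int_iter_on ?W R k (r g0 0)" for k
    using int_iter_on_eqI[OF bij, of "r g0"] by (metis complex_vector.span_base rangeI r_step)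
  moreover obtain K where "norm (R x) \<le> K * norm x" for x
    using bounded_clinear_R by (rule bounded_clinear_pos_bounded) blast
  ultimately show ?thesis
    unfolding bounded_iterates_def
    using bij bounded_clinear_add[OF bounded_clinear_R] bounded_clinear_scaleC[OF bounded_clinear_R]
    by blast
qed

lemma dual_frame_iterates_eq_r:
  assumes "dual_frame f g" "bounded_iterates g"
  shows "g = r (g 0)"
proof (rule r_eqI)
  fix k
  define W where "W = cspan (range g)"
  obtain V K where V_add: "\<And>x y. x \<in> W \<Longrightarrow> y \<in> W \<Longrightarrow> V (x + y) = V x + V y"
    and V_scale: "\<And>a x. x \<in> W \<Longrightarrow> V (a *\<^sub>C x) = a *\<^sub>C V x"
    and K: "\<And>x. x \<in> W \<Longrightarrow> norm (V x) \<le> K * norm x"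
    and bij: "bij_betw V W W" and iter: "\<And>k. g k = int_iter_on W V k (g 0)"
    using assms(2) unfolding bounded_iterates_def W_def by blast
  have gW: "g k \<in> W" for k
    by (simp add: W_def complex_vector.span_base)
  have g_step: "g (k + 1) = V (g k)" for k
    using int_iter_on_mem_step(2)[OF bij gW[of 0]] iter by metis
  have g: "bessel g" and dual: "\<And>x. mixed_operator g f x = x"
    using assms(1) by (auto simp: dual_frame_iff[OF bessel_f])
  have dual': "mixed_operator f g x = x" for x
    by (rule mixed_operator_swap_id[OF g bessel_f dual])
  have "V x = R x" if x: "x \<in> W" for x
  proof -
    \<comment> \<open>\<open>V\<close> is known to be linear and bounded only on \<open>W\<close>,
      but \<open>x\<close> and all partial sums \<open>s F\<close> lie in \<open>W\<close>. The
      bound applied to \<open>x - s F\<close> therefore gives convergence of \<open>V (s F)\<close>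
      to \<open>V x\<close>.\<close>
    define s where "s F = (\<Sum>k\<in>F. cinner x (f k) *\<^sub>C g k)" for F
    have sW: "s F \<in> W" for F
      unfolding s_def W_def
      by (intro complex_vector.span_sum complex_vector.span_scale gW[unfolded W_def])
    have V0: "V 0 = 0"
      using V_scale[OF x, of 0] by simp
    have Vs: "V (s F) = (\<Sum>k\<in>F. cinner x (f k) *\<^sub>C g (k + 1))" if "finite F" for F
      using that
    proof induction
      case (insert j F)
      have "cinner x (f j) *\<^sub>C g j \<in> W"
        using gW unfolding W_def by (rule complex_vector.span_scale)
      with insert show ?case
        using V_add[OF _ sW[of F], of "cinner x (f j) *\<^sub>C g j"]
        by (simp add: s_def V_scale[OF gW] g_step)
    qed (simp add: s_def V0)
    have "norm (V x - V (s F)) \<le> norm (x - s F) * K" for F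
    proof -
      have m: "x - s F \<in> W"
        using x sW unfolding W_def by (rule complex_vector.span_diff)
      have "V x = V (x - s F) + V (s F)"
        using V_add[OF m sW[of F]] by simp
      then show ?thesis
        using K[OF m] by (simp add: mult.commute)
    qed
    then have bound: "norm (V (s F) - V x) \<le> norm (x - s F) * K" for F
      by (simp add: norm_minus_commute)
    have "(s \<longlongrightarrow> x) (finite_subsets_at_top UNIV)"
      using mixed_operator_has_sum[OF bessel_f g, of x] by (simp add: dual' has_sum_def s_def[abs_def])
    then have "((\<lambda>F. norm (x - s F) * K) \<longlongrightarrow> norm (x - x) * K) (finite_subsets_at_top UNIV)"
      by (intro tendsto_intros)
    then have "((\<lambda>F. V (s F) - V x) \<longlongrightarrow> 0) (finite_subsets_at_top UNIV)"
      using Lim_null_comparison[OF always_eventually[OF allI[OF bound]]] by simp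
    then have "((\<lambda>F. V (s F)) \<longlongrightarrow> V x) (finite_subsets_at_top UNIV)"
      by (rule LIM_zero_cancel)
    then have "((\<lambda>F. \<Sum>k\<in>F. cinner x (f k) *\<^sub>C g (k + 1)) \<longlongrightarrow> V x) (finite_subsets_at_top UNIV)"
      by (rule Lim_transform_eventually) (auto intro: eventually_finite_subsets_at_top_weakI Vs)
    then have "V x = mixed_operator f (\<lambda>k. g (k + 1)) x"
      by (intro mixed_operator_eqI[symmetric]) (simp add: has_sum_def)
    \<comment> \<open>By \<open>mixed_operator_R\<close> the shifted series is the expansion of
      \<open>R x\<close> in the family \<open>g\<close>.\<close>
    also have "\<dots> = R x"
      by (simp add: mixed_operator_R[symmetric] dual')
    finally show ?thesis .
  qed
  then show "g (k + 1) = R (g k)"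
    using g_step gW by simp
qed

lemma dual_frame_r:
  assumes h: "bessel (r h)"
  shows "dual_frame f (r (D (f 0) + h - mixed_operator f (r h) (D (f 0))))"
proof -
  define d where "d = r (D (f 0))"
  define M where "M = mixed_operator f (r h)"
  note d = bessel_r_D[folded d_def] and dual = mixed_operator_r_D(2)[folded d_def]
  have M: "bounded_clinear M"
    unfolding M_def by (rule bounded_clinear_mixed_operator[OF bessel_f h])
  note Md = bessel_image[OF d M]
  \<comment> \<open>Since \<open>M\<close> commutes with \<open>R\<close>, the correction terms
    \<open>M (d k)\<close> form an \<open>R\<close>-orbit as well.\<close>
  have r: "r (D (f 0) + h - M (D (f 0))) = (\<lambda>k. d k + r h k - M (d k))"
  proof -
    have "d (k + 1) + r h (k + 1) - M (d (k + 1)) = R (d k + r h k - M (d k))" for k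
      using mixed_operator_r_commute[OF h]
      by (simp add: d_def r_step M_def bounded_clinear_add[OF bounded_clinear_R]
          bounded_clinear_diff[OF bounded_clinear_R])
    then show ?thesis
      using r_eqI[of "\<lambda>k. d k + r h k - M (d k)"] by (simp add: d_def)
  qed
  have "bessel (\<lambda>k. d k + r h k - M (d k))"
    by (intro bessel_add bessel_diff d h Md)
  moreover have "mixed_operator (\<lambda>k. d k + r h k - M (d k)) f x = x" for x
  proof (rule mixed_operator_eqI)
    \<comment> \<open>The adjoint of \<open>M\<close> is \<open>mixed_operator (r h) f\<close>, and
      \<open>d\<close> is dual to \<open>f\<close>; the correction thus contributes exactly what
      \<open>r h\<close> does, with opposite sign.\<close>
    have "mixed_operator (\<lambda>k. M (d k)) f x = mixed_operator d f (mixed_operator (r h) f x)"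
      by (rule mixed_operator_image_left) (metis M_def cinner_mixed_operator[OF h bessel_f])
    then have "mixed_operator (\<lambda>k. M (d k)) f x = mixed_operator (r h) f x"
      by (simp add: dual)
    then have "((\<lambda>k. cinner x (d k) *\<^sub>C f k + cinner x (r h k) *\<^sub>C f k - cinner x (M (d k)) *\<^sub>C f k)
        has_sum x + mixed_operator (r h) f x - mixed_operator (r h) f x) UNIV"
      using mixed_operator_has_sum[OF d bessel_f, of x] mixed_operator_has_sum[OF h bessel_f, of x]
        mixed_operator_has_sum[OF Md bessel_f, of x]
      by (intro has_sum_add has_sum_diff) (simp_all add: dual)
    then show "((\<lambda>k. cinner x (d k + r h k - M (d k)) *\<^sub>C f k) has_sum x) UNIV"
      by (simp add: cinner_add_right cinner_diff_right scaleC_add_left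
          complex_vector.scale_left_diff_distrib)
  qed
  ultimately show ?thesis
    unfolding M_def[symmetric] r by (simp add: dual_frame_iff[OF bessel_f])
qed

lemma dual_frames_iterates:
  "{g. dual_frame f g \<and> bounded_iterates g} =
    {g. \<exists>g0 h0. g = r g0 \<and> bessel (r h0) \<and>
      g0 = D (f 0) + h0 - mixed_operator f (r h0) (D (f 0))}" (is "?L = ?R")
proof
  show "?R \<subseteq> ?L"
    using dual_frame_r bounded_iterates_r by blast
  show "?L \<subseteq> ?R"
  proof clarify
    fix g assume g: "dual_frame f g" "bounded_iterates g"
    note gr = dual_frame_iterates_eq_r[OF g]
    have b: "bessel g" and dual: "\<And>x. mixed_operator g f x = x"
      using g(1) by (auto simp: dual_frame_iff[OF bessel_f])
    \<comment> \<open>The expansion of \<open>D (f 0)\<close> in \<open>g\<close>; with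
      \<open>h0 = g 0\<close> the formula for \<open>g0\<close> collapses to
      \<open>g 0\<close>.\<close>
    have "mixed_operator f (r (g 0)) (D (f 0)) = D (f 0)"
      using mixed_operator_swap_id[OF b bessel_f dual] gr by simp
    then show "\<exists>g0 h0. g = r g0 \<and> bessel (r h0) \<and>
        g0 = D (f 0) + h0 - mixed_operator f (r h0) (D (f 0))"
      using gr b by (intro exI[of _ "g 0"]) simp
  qed
qed

section \<open>A dense subspace of admissible vectors\<close>

lemma closure_span_r_D: "closure (cspan (range (r (D (f 0))))) = UNIV"
proof -
  \<comment> \<open>The partial sums of the canonical dual expansion of \<open>x\<close> lie in the
    span and converge to \<open>x\<close>.\<close>
  have "x \<in> closure (cspan (range (r (D (f 0)))))" for x
  proof (rule Lim_in_closed_set)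
    show "((\<lambda>F. \<Sum>k\<in>F. cinner x (f k) *\<^sub>C r (D (f 0)) k) \<longlongrightarrow> x) (finite_subsets_at_top UNIV)"
      using mixed_operator_has_sum[OF bessel_f bessel_r_D, of x]
      by (simp add: mixed_operator_r_D has_sum_def)
    have "(\<Sum>k\<in>F. cinner x (f k) *\<^sub>C r (D (f 0)) k) \<in> cspan (range (r (D (f 0))))" for F
      by (intro complex_vector.span_sum complex_vector.span_scale complex_vector.span_base rangeI)
    then show "eventually (\<lambda>F. (\<Sum>k\<in>F. cinner x (f k) *\<^sub>C r (D (f 0)) k)
        \<in> closure (cspan (range (r (D (f 0)))))) (finite_subsets_at_top UNIV)"
      using closure_subset by (intro always_eventually) blast
  qed (simp_all add: finite_subsets_at_top_neq_bot)
  then show ?thesis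
    by blast
qed

text \<open>Admissible vectors form a subspace, and the orbit of a generator is a shift of the
  canonical dual family, hence Bessel.\<close>

lemma bessel_r_span:
  assumes "h \<in> cspan (range (r (D (f 0))))"
  shows "bessel (r h)"
  using assms
proof (induction rule: complex_vector.span_induct)
  show "complex_vector.subspace {h. bessel (r h)}"
  proof (rule complex_vector.subspaceI; clarify)
    have scale: "bessel (r (a *\<^sub>C h))" if "bessel (r h)" for a h
      unfolding r_scaleC by (rule bessel_image[OF that bounded_clinear_scaleC_const])
    then show "bessel (r (a *\<^sub>C h))" if "bessel (r h)" for a h
      using that .
    \<comment> \<open>Zero is obtained as the multiple by 0 of the admissible vector
      \<open>D (f 0)\<close>.\<close>
    show "bessel (r 0)"
      using scale[OF bessel_r_D, of 0] by simp
  qed (simp add: r_add bessel_add)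
  fix h assume "h \<in> range (r (D (f 0)))"
  then show "bessel (r h)"
    using bessel_shift[OF bessel_r_D] by (auto simp: r_r)
qed

end

theorem theorem3p5:
  fixes T :: "'a::chilbert_space \<Rightarrow> 'a"
    and f :: "int \<Rightarrow> 'a"
    and f0 f0' :: 'a
  assumes "invertible_clinear T"
    and "\<And>k. f k = int_iter T k f0"
    and "is_frame f"
    and "f0' = inv (frame_operator f) f0"
  shows "(\<forall>h0. bessel (\<lambda>k. int_iter (cadjoint T) (- k) h0) \<longrightarrow>
        (\<lambda>j. cinner f0' (int_iter T j f0) *\<^sub>C int_iter (cadjoint T) (- j) h0) summable_on UNIV)
    \<and> {g. dual_frame f g \<and> bounded_iterates g} =
        {g. \<exists>g0 h0. g = (\<lambda>k. int_iter (cadjoint T) (- k) g0) \<and>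
           bessel (\<lambda>k. int_iter (cadjoint T) (- k) h0) \<and>
           g0 = f0' + h0 -
             (\<Sum>\<^sub>\<infinity>j. cinner f0' (int_iter T j f0) *\<^sub>C int_iter (cadjoint T) (- j) h0)}
    \<and> closure (cspan (range (\<lambda>k. int_iter (cadjoint T) (- k) f0'))) = UNIV
    \<and> (\<forall>h0 \<in> cspan (range (\<lambda>k. int_iter (cadjoint T) (- k) f0')).
        bessel (\<lambda>k. int_iter (cadjoint T) (- k) h0))"
proof -
  obtain T' where T: "bounded_clinear T" "bounded_clinear T'" "T \<circ> T' = id" "T' \<circ> T = id"
    using assms(1) by (auto simp: invertible_clinear_def)
  have bij: "bij T"
    using T(3,4) by (metis o_bij)
  interpret iterated_frame T T' f
  proof
    show "T (T' x) = x" "T' (T x) = x" for x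
      using T(3,4) by (metis comp_apply id_apply)+
    show "f (k + 1) = T (f k)" for k
      unfolding assms(2) by (rule int_iter_on_mem_step(2)[OF bij UNIV_I])
  qed (fact T assms(3))+
  have r: "(\<lambda>k. int_iter (cadjoint T) (- k) h) = r h" for h
    by (simp add: r_def fun_eq_iff)
  have f0': "f0' = D (f 0)"
    by (simp add: D_def assms(2,4))
  have "(\<Sum>\<^sub>\<infinity>j. cinner x (f j) *\<^sub>C r h j) = mixed_operator f (r h) x" for x h
    by (simp add: mixed_operator_def synthesis_def)
  \<comment> \<open>This makes the infinite sum in the formula a genuine limit rather than a default
    value.\<close>
  moreover have "(\<lambda>j. cinner x (f j) *\<^sub>C r h j) summable_on UNIV" if "bessel (r h)" for x h
    using mixed_operator_has_sum[OF bessel_f that] by (rule has_sum_imp_summable)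
  ultimately show ?thesis
    unfolding assms(2)[symmetric] r r_def[symmetric] f0'
    using dual_frames_iterates closure_span_r_D bessel_r_span by simp
qed

end
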